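(* Let $N\ge 3$ be an integer. For $0\le k,j\le N-3$ let $\phi_j(x)=(1-x^2)(1-x)R_j^{(2,1)}(x)$, $\psi_k(x)=(1-x^2)(1+x)R_k^{(1,2)}(x)$, and let $B_1=(b^1_{kj})$, $E_2=(e^{2,1}_{kj})$, $E_1=(e^{1,1}_{kj})$, $E_0=(e^{0,1}_{kj})$ (rows $k$, columns $j$, $0\le k,j\le N-3$) be the matrices of the linear system $$(B_1+\alpha_1E_2+\beta_1E_1+\gamma_1E_0)\,\mathbf a=\mathbf f^*$$ that arises from the dual Petrov-Galerkin discretization of $u^{(3)}-\alpha_1u^{(2)}-\beta_1u^{(1)}+\gamma_1u=f$ on $(-1,1)$, $u(\pm1)=u^{(1)}(1)=0$; that is, with $h_k=\frac{8}{(k+1)(k+2)(k+3)}$ and $(u,v)=\int_{-1}^1uv\,dx$, $$b^1_{kj}=\frac{(D^3\phi_j,\psi_k)}{h_k},\quad e^{2,1}_{kj}=-\frac{(D^2\phi_j,\psi_k)}{h_k},\quad e^{1,1}_{kj}=-\frac{(D\phi_j,\psi_k)}{h_k},\quad e^{0,1}_{kj}=\frac{(\phi_j,\psi_k)}{h_k}.$$ Then the nonzero elements of these matrices are the following (for all $k\ge0$ for which the row and column indices lie in $\{0,\dots,N-3\}$), and all other entries are zero: $$b^1_{kk}=2(k+1)(k+3);$$ $$e^{2,1}_{k,k+1}=\frac{2(k+1)(k+2)}{2k+5},\quad e^{2,1}_{k+1,k}=\frac{-2(k+3)(k+4)}{2k+5},\quad e^{2,1}_{kk}=\frac{4(k+1)(k+3)}{(2k+3)(2k+5)};$$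 $$e^{1,1}_{kk}=\frac{4(k+1)(k+3)}{(2k+3)(2k+5)},\quad e^{1,1}_{k,k+1}=\frac{-8(k+1)(k+2)}{(2k+3)(2k+5)(2k+7)},\quad e^{1,1}_{k,k+2}=\frac{-2(k+1)(k+2)(k+3)}{(k+4)(2k+5)(2k+7)},$$ $$e^{1,1}_{k+1,k}=\frac{8(k+3)(k+4)}{(2k+3)(2k+5)(2k+7)},\quad e^{1,1}_{k+2,k}=\frac{-2(k+3)(k+4)(k+5)}{(k+2)(2k+5)(2k+7)};$$ $$e^{0,1}_{kk}=\frac{3(k+1)(k+3)}{2(k+\frac12)_4},\quad e^{0,1}_{k,k+1}=\frac{3(k+1)_2}{4(k+\frac32)_3},\quad e^{0,1}_{k,k+2}=\frac{-3(k+1)_3}{4(k+4)(k+\frac32)_4},\quad e^{0,1}_{k,k+3}=\frac{-(k+1)_3}{4(k+5)(k+\frac52)_3},$$ $$e^{0,1}_{k+1,k}=\frac{-3(k+3)_2}{4(k+\frac32)_3},\quad e^{0,1}_{k+2,k}=\frac{-3(k+3)_3}{4(k+2)(k+\frac32)_4},\quad e^{0,1}_{k+3,k}=\frac{(k+4)_3}{4(k+2)(k+\frac52)_3}.$$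
   Context: $D=d/dx$, and $(a)_m=a(a+1)\cdots(a+m-1)$ is the Pochhammer symbol. For $\alpha,\beta>-1$, $R_n^{(\alpha,\beta)}(x)=P_n^{(\alpha,\beta)}(x)/P_n^{(\alpha,\beta)}(1)$ is the Jacobi polynomial of degree $n$ normalized to equal $1$ at $x=1$; explicitly $$R_n^{(\alpha,\beta)}(x)=\left(-\tfrac12\right)^n\frac{\Gamma(\alpha+1)}{\Gamma(n+\alpha+1)}(1-x)^{-\alpha}(1+x)^{-\beta}D^n\left[(1-x)^{\alpha+n}(1+x)^{\beta+n}\right].$$ The functions $\phi_k=J_{k+3}^{(-2,-1)}$ and $\psi_k=J_{k+3}^{(-1,-2)}$ are generalized Jacobi polynomials. The dual Petrov-Galerkin approximation is $u_N=\sum_{k=0}^{N-3}a_k\phi_k$, in $V_N=\mathrm{span}\{\phi_0,\dots,\phi_{N-3}\}$ (the polynomials of degree at most $N$ satisfying $u(\pm1)=u'(1)=0$), such that $(D^3u_N-\alpha_1D^2u_N-\beta_1Du_N+\gamma_1u_N,v)=(f,v)$ for all $v\in V_N^*=\mathrm{span}\{\psi_0,\dots,\psi_{N-3}\}$ (the polynomials of degree at most $N$ satisfying $v(\pm1)=v'(-1)=0$). Testing with $v=\psi_k$ and dividing by $h_k=\int_{-1}^1(1-x)(1+x)^2[R_k^{(1,2)}(x)]^2dx=\frac{8}{(k+1)(k+2)(k+3)}$ gives the linear system in the claim, with $\mathbf a=(a_0,\dots,a_{N-3})^T$ and $\mathbf f^*=(f_0^*,\dots,f_{N-3}^* )^T$,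 $f_k^*=(f,\psi_k)/h_k$. *)

theory Defs
  imports "HOL-Analysis.Analysis" "Jordan_Normal_Form.Matrix"
begin

definition jacobi_rodrigues :: "real \<Rightarrow> real \<Rightarrow> nat \<Rightarrow> real \<Rightarrow> real" where
  "jacobi_rodrigues \<alpha> \<beta> n x =
     (- 1 / 2) ^ n * (Gamma (\<alpha> + 1) / Gamma (real n + \<alpha> + 1)) *
     (1 - x) powr (- \<alpha>) * (1 + x) powr (- \<beta>) *
     (deriv ^^ n) (\<lambda>t. (1 - t) powr (\<alpha> + real n) * (1 + t) powr (\<beta> + real n)) x"

text \<open>
  The Rodrigues formula determines the values of \<open>R\<^sub>n\<close> only on the open interval \<open>(-1, 1)\<close>
  (\<open>powr\<close> gives junk values at and beyond the endpoints), so \<open>R\<^sub>n\<close> is the unique polynomial that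
  agrees with it there. Existence, uniqueness and the normalization at 1 are proved below.
\<close>

definition jacobi_R :: "real \<Rightarrow> real \<Rightarrow> nat \<Rightarrow> real poly" where
  "jacobi_R \<alpha> \<beta> n = (THE p. \<forall>x\<in>{-1<..<1}. poly p x = jacobi_rodrigues \<alpha> \<beta> n x)"

lemma iterated_deriv_jacobi_weight:
  fixes a b :: real
  shows "\<exists>q. (\<forall>x\<in>{-1<..<1}. (deriv ^^ m) (\<lambda>t. (1 - t) powr a * (1 + t) powr b) x =
                poly q x * ((1 - x) powr (a - real m) * (1 + x) powr (b - real m))) \<and>
             poly q 1 = (- 2) ^ m * (\<Prod>i<m. a - real i)"
proof (induction m)
  case 0
  show ?case by (rule exI[of _ 1]) auto
next
  case (Suc m)
  let ?f = "\<lambda>t::real. (1 - t) powr a * (1 + t) powr b"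
  obtain q where q: "\<And>x. x \<in> {-1<..<1} \<Longrightarrow> (deriv ^^ m) ?f x =
      poly q x * ((1 - x) powr (a - real m) * (1 + x) powr (b - real m))"
    and q1: "poly q 1 = (- 2) ^ m * (\<Prod>i<m. a - real i)"
    using Suc.IH by blast
  define c where "c = a - real m"
  define d where "d = b - real m"
  define p where "p = pderiv q * ([:1, -1:] * [:1, 1:]) - Polynomial.smult c (q * [:1, 1:])
                      + Polynomial.smult d (q * [:1, -1:])"
  have "(deriv ^^ Suc m) ?f x =
      poly p x * ((1 - x) powr (a - real (Suc m)) * (1 + x) powr (b - real (Suc m)))"
    if x: "x \<in> {-1<..<1}" for x
  proof -
    have "eventually (\<lambda>y. y \<in> {-1<..<1::real}) (nhds x)"
      using x by (intro eventually_nhds_in_open) auto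
    then have ev: "eventually (\<lambda>y. (deriv ^^ m) ?f y =
        poly q y * ((1 - y) powr c * (1 + y) powr d)) (nhds x)"
      by eventually_elim (simp add: q c_def d_def)
    have s: "(1 - x) powr c = (1 - x) * (1 - x) powr (c - 1)"
      "(1 + x) powr d = (1 + x) * (1 + x) powr (d - 1)"
      using x by (simp_all add: powr_diff)
    have "((\<lambda>y. poly q y * ((1 - y) powr c * (1 + y) powr d)) has_real_derivative
        poly (pderiv q) x * ((1 - x) powr c * (1 + x) powr d) +
        poly q x * (- c * (1 - x) powr (c - 1) * (1 + x) powr d +
                    (1 - x) powr c * (d * (1 + x) powr (d - 1)))) (at x)"
      using x by (auto intro!: derivative_eq_intros poly_DERIV simp: algebra_simps)
    then have "deriv (\<lambda>y. poly q y * ((1 - y) powr c * (1 + y) powr d)) x =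
        poly p x * ((1 - x) powr (c - 1) * (1 + x) powr (d - 1))"
      by (subst DERIV_imp_deriv, assumption) (simp add: s p_def algebra_simps)
    moreover have "c - 1 = a - real (Suc m)" "d - 1 = b - real (Suc m)"
      by (simp_all add: c_def d_def)
    ultimately show ?thesis
      using deriv_cong_ev[OF ev refl] by simp
  qed
  moreover have "poly p 1 = (- 2) ^ Suc m * (\<Prod>i<Suc m. a - real i)"
    by (simp add: p_def q1 c_def)
  ultimately show ?case by blast
qed

lemma jacobi_R_unique:
  assumes "\<forall>x\<in>{-1<..<1}. poly p x = jacobi_rodrigues \<alpha> \<beta> n x"
    and "\<forall>x\<in>{-1<..<1}. poly q x = jacobi_rodrigues \<alpha> \<beta> n x"
  shows "p = q"
proof (rule ccontr)
  assume "p \<noteq> q"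
  then have "finite {x. poly (p - q) x = 0}" by (intro poly_roots_finite) auto
  moreover have "{-1<..<1} \<subseteq> {x. poly (p - q) x = 0}" using assms by auto
  ultimately have "finite {-1<..<1::real}" by (rule finite_subset[rotated])
  then show False by (simp add: infinite_Ioo)
qed

lemma jacobi_R_exists:
  assumes "\<alpha> > -1"
  shows "\<exists>p. (\<forall>x\<in>{-1<..<1}. poly p x = jacobi_rodrigues \<alpha> \<beta> n x) \<and> poly p 1 = 1"
proof -
  obtain q where q: "\<And>x. x \<in> {-1<..<1} \<Longrightarrow>
        (deriv ^^ n) (\<lambda>t. (1 - t) powr (\<alpha> + real n) * (1 + t) powr (\<beta> + real n)) x =
        poly q x * ((1 - x) powr \<alpha> * (1 + x) powr \<beta>)"
    and q1: "poly q 1 = (- 2) ^ n * (\<Prod>i<n. \<alpha> + real n - real i)"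
    using iterated_deriv_jacobi_weight[of n "\<alpha> + real n" "\<beta> + real n"] by auto
  let ?c = "(- 1 / 2) ^ n * (Gamma (\<alpha> + 1) / Gamma (real n + \<alpha> + 1))"
  have "poly (Polynomial.smult ?c q) x = jacobi_rodrigues \<alpha> \<beta> n x" if "x \<in> {-1<..<1}" for x
    unfolding jacobi_rodrigues_def q[OF that] using that
    by (simp add: powr_minus field_simps)
  moreover have "poly (Polynomial.smult ?c q) 1 = 1"
  proof -
    have "(\<Prod>i<n. \<alpha> + real n - real i) = pochhammer (\<alpha> + 1) n"
      unfolding pochhammer_prod atLeast0LessThan[symmetric]
      by (rule prod.reindex_bij_witness[of _ "\<lambda>i. n - 1 - i" "\<lambda>i. n - 1 - i"])
         (auto simp: of_nat_diff)
    also have "\<dots> = Gamma (\<alpha> + 1 + real n) / Gamma (\<alpha> + 1)"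
      using assms by (intro pochhammer_Gamma) (auto elim!: nonpos_Ints_cases)
    finally have "poly q 1 = (- 2) ^ n * (Gamma (real n + \<alpha> + 1) / Gamma (\<alpha> + 1))"
      using q1 by (simp add: add_ac)
    moreover have "Gamma (\<alpha> + 1) > 0" "Gamma (real n + \<alpha> + 1) > 0"
      using assms by (auto intro!: Gamma_real_pos)
    moreover have "(- 1 / 2) ^ n * (- 2) ^ n = (1::real)"
      by (simp flip: power_mult_distrib)
    ultimately show ?thesis by simp
  qed
  ultimately show ?thesis by blast
qed

lemma jacobi_R:
  assumes "\<alpha> > -1"
  shows "\<forall>x\<in>{-1<..<1}. poly (jacobi_R \<alpha> \<beta> n) x = jacobi_rodrigues \<alpha> \<beta> n x"
    and "poly (jacobi_R \<alpha> \<beta> n) 1 = 1"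
proof -
  obtain p where p: "\<forall>x\<in>{-1<..<1}. poly p x = jacobi_rodrigues \<alpha> \<beta> n x" "poly p 1 = 1"
    using jacobi_R_exists[OF assms] by blast
  have "jacobi_R \<alpha> \<beta> n = p"
    unfolding jacobi_R_def using p(1) jacobi_R_unique by (intro the_equality) auto
  with p show "\<forall>x\<in>{-1<..<1}. poly (jacobi_R \<alpha> \<beta> n) x = jacobi_rodrigues \<alpha> \<beta> n x"
    and "poly (jacobi_R \<alpha> \<beta> n) 1 = 1" by simp_all
qed

definition phi :: "nat \<Rightarrow> real \<Rightarrow> real" where
  "phi j x = (1 - x\<^sup>2) * (1 - x) * poly (jacobi_R 2 1 j) x"

definition psi :: "nat \<Rightarrow> real \<Rightarrow> real" where
  "psi k x = (1 - x\<^sup>2) * (1 + x) * poly (jacobi_R 1 2 k) x"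

definition ip :: "(real \<Rightarrow> real) \<Rightarrow> (real \<Rightarrow> real) \<Rightarrow> real" where
  "ip u v = integral {-1..1} (\<lambda>x. u x * v x)"

definition h :: "nat \<Rightarrow> real" where
  "h k = 8 / ((real k + 1) * (real k + 2) * (real k + 3))"

text \<open>Rows and columns are indexed by \<open>0, \<dots>, N - 3\<close>, so the matrices have size \<open>N - 2\<close>.\<close>

definition B1 :: "nat \<Rightarrow> real mat" where
  "B1 N = Matrix.mat (N - 2) (N - 2) (\<lambda>(k, j). ip ((deriv ^^ 3) (phi j)) (psi k) / h k)"

definition E2 :: "nat \<Rightarrow> real mat" where
  "E2 N = Matrix.mat (N - 2) (N - 2) (\<lambda>(k, j). - ip ((deriv ^^ 2) (phi j)) (psi k) / h k)"

definition E1 :: "nat \<Rightarrow> real mat" where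
  "E1 N = Matrix.mat (N - 2) (N - 2) (\<lambda>(k, j). - ip (deriv (phi j)) (psi k) / h k)"

definition E0 :: "nat \<Rightarrow> real mat" where
  "E0 N = Matrix.mat (N - 2) (N - 2) (\<lambda>(k, j). ip (phi j) (psi k) / h k)"

end

theory Submission
  imports Defs
begin

text \<open>
  By the Rodrigues formula \<open>\<phi>\<^sub>j\<close> is a multiple of
  \<open>D\<^sup>j [(1 - x) (1 - x\<^sup>2)\<^bsup>j+1\<^esup>]\<close>, and \<open>(1 - x) (1 - x\<^sup>2)\<^sup>n\<close> is a linear combination of \<open>(1 - x\<^sup>2)\<^sup>n\<close> and
  \<open>D [(1 - x\<^sup>2)\<^bsup>n+1\<^esup>]\<close>. Hence, with Legendre polynomials \<open>P\<^sub>n\<close>,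
  \<open>D \<phi>\<^sub>j = - 4 / (j + 2) (P\<^bsub>j+1\<^esub> - P\<^bsub>j+2\<^esub>)\<close>, and in the same way
  \<open>D \<psi>\<^sub>k = - 2 (P\<^bsub>k+1\<^esub> + P\<^bsub>k+2\<^esub>)\<close>. Since \<open>\<psi>\<^sub>k\<close> vanishes at both
  endpoints, integration by parts turns the entries with two and three derivatives into
  integrals of \<open>P\<^sub>m P\<^sub>n\<close> and \<open>D P\<^sub>m P\<^sub>n\<close>; for the other two, \<open>\<phi>\<^sub>j\<close> and \<open>\<psi>\<^sub>k\<close> are written
  in terms of \<open>\<integral> P\<^bsub>n+1\<^esub> = (P\<^bsub>n+2\<^esub> - P\<^sub>n) / (2n + 3)\<close>. Orthogonality of the \<open>P\<^sub>n\<close> then gives the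
  band structure and the values.
\<close>

section \<open>Polynomial derivatives and the Rodrigues formula\<close>

lemma higher_pderiv_diff:
  "(pderiv ^^ n) (p - q :: 'a :: idom poly) = (pderiv ^^ n) p - (pderiv ^^ n) q"
  by (induction n) (simp_all add: pderiv_diff)

lemma deriv_poly: "deriv (poly p) = poly (pderiv (p :: real poly))"
  by (intro ext DERIV_imp_deriv poly_DERIV)

lemma higher_deriv_poly: "(deriv ^^ n) (poly p) = poly ((pderiv ^^ n) (p :: real poly))"
  by (induction n) (simp_all add: deriv_poly)

text \<open>A nonzero difference has only finitely many roots. This lifts identities to polynomials
  from (-1, 1), where the Rodrigues formula fixes the values.\<close>

lemma poly_eq_on_interval:
  fixes p q :: "real poly"
  assumes "\<And>x. x \<in> {-1<..<1} \<Longrightarrow> poly p x = poly q x"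
  shows "p = q"
proof (rule ccontr)
  assume "p \<noteq> q"
  then have "finite {x. poly (p - q) x = 0}" by (intro poly_roots_finite) auto
  moreover have "{-1<..<1} \<subseteq> {x. poly (p - q) x = 0}" using assms by auto
  ultimately have "finite {-1<..<1::real}" by (rule finite_subset[rotated])
  then show False by (simp add: infinite_Ioo)
qed

text \<open>Each differentiation costs at most one factor \<open>p\<close>. The cofactor changes
  along the way, so the induction is over all \<open>q\<close>.\<close>

lemma power_dvd_higher_pderiv:
  fixes p q :: "'a :: idom poly"
  shows "p ^ m dvd (pderiv ^^ n) (p ^ (m + n) * q)"
proof (induction n arbitrary: q)
  case (Suc n)
  have "pderiv (p ^ (m + Suc n) * q) =
      p ^ (m + n) * (p * pderiv q + q * Polynomial.smult (of_nat (Suc (m + n))) (pderiv p))"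
    by (simp add: pderiv_mult pderiv_power_Suc algebra_simps del: power_Suc of_nat_Suc)
       (simp add: algebra_simps)
  with Suc[of "p * pderiv q + q * Polynomial.smult (of_nat (Suc (m + n))) (pderiv p)"]
  show ?case by (simp add: funpow_Suc_right del: funpow.simps)
qed simp

lemma poly_higher_pderiv_root:
  fixes p q :: "'a :: idom poly"
  assumes "poly p x = 0" and "n < k"
  shows "poly ((pderiv ^^ n) (p ^ k * q)) x = 0"
proof -
  obtain m where "k = Suc m + n"
    using less_imp_Suc_add[OF assms(2)] by (auto simp: add.commute)
  then have "p dvd (pderiv ^^ n) (p ^ k * q)"
    using power_dvd_higher_pderiv[of p "Suc m" n q] by (auto intro: dvd_trans[rotated])
  with assms(1) show ?thesis by (auto elim!: dvdE)
qed

text \<open>On (-1, 1) \<open>powr\<close> with a natural exponent is the ordinary power, and the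
  Gamma values are factorials. Multiplying by the weight clears the negative powers, so both sides
  are polynomials that agree on the interval.\<close>

lemma jacobi_R_poly:
  fixes a b n :: nat
  defines "w \<equiv> [:1, -1:] :: real poly" and "v \<equiv> [:1, 1:] :: real poly"
  shows "w ^ a * v ^ b * jacobi_R (real a) (real b) n =
    Polynomial.smult ((- 1 / 2) ^ n * fact a / fact (a + n)) ((pderiv ^^ n) (w ^ (a + n) * v ^ (b + n)))"
proof (rule poly_eq_on_interval)
  fix x :: real assume x: "x \<in> {-1<..<1}"
  have "(deriv ^^ n) (\<lambda>t. (1 - t) powr (real a + real n) * (1 + t) powr (real b + real n)) x
      = (deriv ^^ n) (poly (w ^ (a + n) * v ^ (b + n))) x"
  proof (rule higher_deriv_cong_ev)
    have "eventually (\<lambda>t. t \<in> {-1<..<1::real}) (nhds x)"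
      using x by (intro eventually_nhds_in_open) auto
    then show "\<forall>\<^sub>F t in nhds x. (1 - t) powr (real a + real n) * (1 + t) powr (real b + real n) =
        poly (w ^ (a + n) * v ^ (b + n)) t"
      by eventually_elim (simp add: w_def v_def powr_realpow flip: of_nat_add)
  qed simp
  moreover have "poly (jacobi_R (real a) (real b) n) x = jacobi_rodrigues (real a) (real b) n x"
    using jacobi_R(1)[of "real a" "real b" n] x by simp
  moreover have "Gamma (real a + 1) = fact a" "Gamma (real n + real a + 1) = fact (a + n)"
    using Gamma_fact[of a, where 'a = real] Gamma_fact[of "a + n", where 'a = real]
    by (simp_all add: add_ac)
  ultimately show "poly (w ^ a * v ^ b * jacobi_R (real a) (real b) n) x =
      poly (Polynomial.smult ((- 1 / 2) ^ n * fact a / fact (a + n)) ((pderiv ^^ n) (w ^ (a + n) * v ^ (b + n)))) x"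
    using x by (simp add: jacobi_rodrigues_def higher_deriv_poly powr_minus powr_realpow field_simps w_def v_def)
qed

section \<open>Legendre polynomials: endpoint values and the derivative recurrence\<close>

text \<open>The classical P_n by its Rodrigues formula. The base is 1 - x^2 rather than x^2 - 1,
  which accounts for the sign in (-1/2)^n.\<close>

definition legendre :: "nat \<Rightarrow> real poly" where
  "legendre n = Polynomial.smult ((- 1 / 2) ^ n / fact n) ((pderiv ^^ n) ([:1, 0, -1:] ^ n))"

lemma degree_legendre: "Polynomial.degree (legendre n) \<le> n"
proof -
  have "Polynomial.degree ([:1, 0, -1:] ^ n :: real poly) \<le> 2 * n"
    using degree_power_le[of "[:1, 0, -1:] :: real poly" n] by simp
  then show ?thesis
    by (simp add: legendre_def degree_higher_pderiv)
qed

lemma higher_pderiv_legendre: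
  "(pderiv ^^ n) ([:1, 0, -1:] ^ n) = Polynomial.smult ((- 2) ^ n * fact n) (legendre n)"
proof -
  have "(- 2) ^ n * (- 1 / 2) ^ n = (1 :: real)"
    by (simp flip: power_mult_distrib)
  then show ?thesis by (simp add: legendre_def)
qed

lemma pderiv_legendre_weight:
  "pderiv ([:1, 0, -1:] ^ Suc n) =
    Polynomial.smult (- 2 * (real n + 1)) ([:0, 1:] * [:1, 0, -1:] ^ n)"
  by (simp add: pderiv_power_Suc pderiv_pCons algebra_simps del: power_Suc, rule poly_eqI)
     (simp add: algebra_simps)

text \<open>Up to the factor -2(n+1), x (1-x^2)^n is the derivative of (1-x^2)^(n+1), so n further
  derivatives produce P_(n+1). That factor is cancelled at the end.\<close>

lemma higher_pderiv_x_legendre_weight: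
  "(pderiv ^^ n) ([:0, 1:] * [:1, 0, -1:] ^ n) =
    Polynomial.smult ((- 2) ^ n * fact n) (legendre (Suc n))"
proof -
  define c where "c = - 2 * (real n + 1)"
  have "Polynomial.smult c ((pderiv ^^ n) ([:0, 1:] * [:1, 0, -1:] ^ n)) =
      Polynomial.smult ((- 2) ^ Suc n * fact (Suc n)) (legendre (Suc n))"
    unfolding higher_pderiv_legendre[symmetric] funpow_Suc_right o_apply pderiv_legendre_weight
      higher_pderiv_smult c_def ..
  also have "(- 2) ^ Suc n * fact (Suc n) = c * ((- 2) ^ n * fact n)"
    by (simp add: c_def algebra_simps)
  finally have "Polynomial.smult c ((pderiv ^^ n) ([:0, 1:] * [:1, 0, -1:] ^ n)) =
      Polynomial.smult c (Polynomial.smult ((- 2) ^ n * fact n) (legendre (Suc n)))"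
    by (simp only: smult_smult)
  moreover have "c \<noteq> 0" by (simp add: c_def)
  ultimately show ?thesis by (simp only: smult_cancel)
qed

lemma higher_pderiv_minus_legendre:
  "(pderiv ^^ n) ([:1, -1:] * [:1, 0, -1:] ^ n) =
    Polynomial.smult ((- 2) ^ n * fact n) (legendre n - legendre (Suc n))"
proof -
  have "[:1, -1:] * [:1, 0, -1:] ^ n = [:1, 0, -1:] ^ n - [:0, 1:] * ([:1, 0, -1:] ^ n :: real poly)"
    by simp
  then show ?thesis
    by (simp add: higher_pderiv_diff higher_pderiv_legendre higher_pderiv_x_legendre_weight
        smult_diff_right del: mult_pCons_left)
qed

lemma higher_pderiv_plus_legendre:
  "(pderiv ^^ n) ([:1, 1:] * [:1, 0, -1:] ^ n) =
    Polynomial.smult ((- 2) ^ n * fact n) (legendre n + legendre (Suc n))"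
proof -
  have "[:1, 1:] * [:1, 0, -1:] ^ n = [:1, 0, -1:] ^ n + [:0, 1:] * ([:1, 0, -1:] ^ n :: real poly)"
    by simp
  then show ?thesis
    by (simp add: higher_pderiv_add higher_pderiv_legendre higher_pderiv_x_legendre_weight
        smult_add_right del: mult_pCons_left)
qed

lemma legendre_weight_factor:
  "[:1, 0, -1:] ^ n = [:1, -1:] ^ n * ([:1, 1:] ^ n :: real poly)"
  by (simp flip: power_mult_distrib)

text \<open>(1-x)(1-x^2)^n has a zero of order n+1 at 1, so its n-th derivative vanishes there. By
  \<open>higher_pderiv_minus_legendre\<close> this says P_n(1) = P_(n+1)(1).\<close>

lemma legendre_at_1: "poly (legendre n) 1 = 1"
proof (induction n)
  case (Suc n)
  have "poly ((pderiv ^^ n) ([:1, -1:] ^ Suc n * [:1, 1:] ^ n)) (1::real) = 0"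
    by (rule poly_higher_pderiv_root) auto
  moreover have "[:1, -1:] ^ Suc n * [:1, 1:] ^ n = [:1, -1:] * ([:1, 0, -1:] ^ n :: real poly)"
    by (simp only: legendre_weight_factor power_Suc mult_ac)
  ultimately show ?case
    by (simp only: higher_pderiv_minus_legendre) (simp add: Suc)
qed (simp add: legendre_def)

text \<open>The same argument with (1+x)(1-x^2)^n at -1 gives P_(n+1)(-1) = -P_n(-1).\<close>

lemma legendre_at_minus_1: "poly (legendre n) (- 1) = (- 1) ^ n"
proof (induction n)
  case (Suc n)
  have "poly ((pderiv ^^ n) ([:1, 1:] ^ Suc n * [:1, -1:] ^ n)) (-1::real) = 0"
    by (rule poly_higher_pderiv_root) auto
  moreover have "[:1, 1:] ^ Suc n * [:1, -1:] ^ n = [:1, 1:] * ([:1, 0, -1:] ^ n :: real poly)"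
    by (simp only: legendre_weight_factor power_Suc mult_ac)
  ultimately show ?case
    by (simp only: higher_pderiv_plus_legendre) (simp add: Suc)
qed (simp add: legendre_def)

text \<open>D[x (1-x^2)^(n+1)] is a combination of (1-x^2)^(n+1) and (1-x^2)^n. Applying D^(n+1)
  turns the three terms into multiples of P_(n+2)', P_(n+1) and P_n'.\<close>

lemma pderiv_legendre_diff:
  "pderiv (legendre (n + 2)) - pderiv (legendre n) = Polynomial.smult (2 * real n + 3) (legendre (n + 1))"
proof -
  let ?V = "\<lambda>n. [:1, 0, -1:] ^ n :: real poly"
  have x2: "[:0, 1:] * ([:0, 1:] * ?V n) = ?V n - ?V (Suc n)"
    by (simp add: algebra_simps)
  have "pderiv ([:0, 1:] * ?V (Suc n)) = ?V (Suc n) + [:0, 1:] * pderiv (?V (Suc n))"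
    by (simp only: pderiv_mult) (simp add: pderiv_pCons)
  also have "\<dots> = ?V (Suc n) + Polynomial.smult (- 2 * (real n + 1)) (?V n - ?V (Suc n))"
    by (simp only: pderiv_legendre_weight mult_smult_right x2)
  also have "\<dots> = Polynomial.smult (2 * real n + 3) (?V (Suc n)) - Polynomial.smult (2 * (real n + 1)) (?V n)"
    by (rule poly_eqI) (simp add: algebra_simps del: power_Suc)
  finally have D: "pderiv ([:0, 1:] * ?V (Suc n)) = \<dots>" .
  \<comment> \<open>This constant is common to all three terms: the extra factor -2(n+1) of the last
    one completes (-2)^n n! to \<open>c\<close>.\<close>
  define c :: real where "c = (- 2) ^ Suc n * fact (Suc n)"
  have c: "c = - 2 * (real n + 1) * ((- 2) ^ n * fact n)" "c \<noteq> 0"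
    by (simp_all only: c_def power_Suc fact_Suc of_nat_Suc mult_ac add_ac) simp_all
  have "Polynomial.smult c (pderiv (legendre (n + 2))) =
      pderiv ((pderiv ^^ Suc n) ([:0, 1:] * ?V (Suc n)))"
    by (simp only: higher_pderiv_x_legendre_weight pderiv_smult c_def add_2_eq_Suc')
  also have "\<dots> = (pderiv ^^ Suc n) (Polynomial.smult (2 * real n + 3) (?V (Suc n))
      - Polynomial.smult (2 * (real n + 1)) (?V n))"
    by (simp only: D[symmetric] funpow_swap1[of pderiv])
  also have "\<dots> = Polynomial.smult (2 * real n + 3) (Polynomial.smult c (legendre (Suc n)))
      - Polynomial.smult (2 * (real n + 1)) (pderiv ((pderiv ^^ n) (?V n)))"
    by (simp only: higher_pderiv_diff higher_pderiv_smult higher_pderiv_legendre c_def)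
       (simp add: higher_pderiv_legendre)
  also have "\<dots> = Polynomial.smult c (Polynomial.smult (2 * real n + 3) (legendre (n + 1)) + pderiv (legendre n))"
    unfolding higher_pderiv_legendre pderiv_smult
    by (rule poly_eqI) (simp add: c(1) algebra_simps)
  finally have "pderiv (legendre (n + 2)) = Polynomial.smult (2 * real n + 3) (legendre (n + 1)) + pderiv (legendre n)"
    using c(2) by (simp only: smult_cancel)
  then show ?thesis by simp
qed

section \<open>The inner product on polynomials and Legendre orthogonality\<close>

definition poly_ip :: "real poly \<Rightarrow> real poly \<Rightarrow> real" where
  "poly_ip p q = integral {-1..1} (poly (p * q))"

lemma integrable_poly: "poly (p :: real poly) integrable_on {a..b}"
  by (intro integrable_continuous_interval continuous_intros)

lemma ip_poly: "ip (poly p) (poly q) = poly_ip p q"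
  by (simp add: ip_def poly_ip_def poly_mult[abs_def])

lemma poly_ip_commute: "poly_ip p q = poly_ip q p"
  by (simp add: poly_ip_def mult.commute)

lemma poly_ip_0_right [simp]: "poly_ip p 0 = 0"
  by (simp add: poly_ip_def poly_0[abs_def])

lemma poly_ip_add_left: "poly_ip (p + q) r = poly_ip p r + poly_ip q r"
  using integral_add[OF integrable_poly[of "p * r" "-1" 1] integrable_poly[of "q * r" "-1" 1]]
  by (simp add: poly_ip_def distrib_right poly_add[abs_def])

lemma poly_ip_diff_left: "poly_ip (p - q) r = poly_ip p r - poly_ip q r"
  using integral_diff[OF integrable_poly[of "p * r" "-1" 1] integrable_poly[of "q * r" "-1" 1]]
  by (simp add: poly_ip_def left_diff_distrib poly_diff[abs_def])

lemma poly_ip_smult_left: "poly_ip (Polynomial.smult c p) q = c * poly_ip p q"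
  by (simp add: poly_ip_def poly_smult[abs_def] del: poly_mult)

lemma poly_ip_add_right: "poly_ip r (p + q) = poly_ip r p + poly_ip r q"
  by (simp add: poly_ip_commute[of r] poly_ip_add_left)

lemma poly_ip_diff_right: "poly_ip r (p - q) = poly_ip r p - poly_ip r q"
  by (simp add: poly_ip_commute[of r] poly_ip_diff_left)

lemma poly_ip_smult_right: "poly_ip p (Polynomial.smult c q) = c * poly_ip p q"
  by (simp add: poly_ip_commute[of p] poly_ip_smult_left)

lemma poly_ip_minus_left: "poly_ip (- p) q = - poly_ip p q"
  using poly_ip_diff_left[of 0 p q] by (simp add: poly_ip_commute[of 0])

lemma poly_ip_minus_right: "poly_ip p (- q) = - poly_ip p q"
  by (simp add: poly_ip_commute[of p] poly_ip_minus_left)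

lemmas poly_ip_smult = poly_ip_smult_left poly_ip_smult_right poly_ip_minus_left poly_ip_minus_right

lemmas poly_ip_linear = poly_ip_add_left poly_ip_diff_left poly_ip_add_right poly_ip_diff_right poly_ip_smult

lemma poly_ip_by_parts:
  "poly_ip (pderiv p) q = poly (p * q) 1 - poly (p * q) (- 1) - poly_ip p (pderiv q)"
proof -
  have "(poly (pderiv (p * q)) has_integral poly (p * q) 1 - poly (p * q) (- 1)) {-1..1}"
    by (rule fundamental_theorem_of_calculus)
       (auto intro!: DERIV_subset[OF poly_DERIV] simp del: poly_mult
         simp flip: has_real_derivative_iff_has_vector_derivative)
  then have "integral {-1..1} (poly (pderiv (p * q))) = poly (p * q) 1 - poly (p * q) (- 1)"
    by (rule integral_unique)
  moreover have "integral {-1..1} (poly (pderiv (p * q))) = poly_ip (pderiv p) q + poly_ip p (pderiv q)"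
    using poly_ip_add_right[of 1 "p * pderiv q" "q * pderiv p"]
    by (simp add: poly_ip_def pderiv_mult mult.commute)
  ultimately show ?thesis by simp
qed

text \<open>The integral of P_(n+1) from -1 to x. The index is shifted because only from P_1 on does
  this primitive vanish at 1 as well, which removes the boundary terms.\<close>

definition legendre_prim :: "nat \<Rightarrow> real poly" where
  "legendre_prim n = Polynomial.smult (1 / (2 * real n + 3)) (legendre (n + 2) - legendre n)"

lemma pderiv_legendre_prim: "pderiv (legendre_prim n) = legendre (n + 1)"
  by (simp only: legendre_prim_def pderiv_smult pderiv_diff pderiv_legendre_diff) simp

lemma legendre_prim_at_1: "poly (legendre_prim n) 1 = 0"
  and legendre_prim_at_minus_1: "poly (legendre_prim n) (- 1) = 0"
  by (simp_all add: legendre_prim_def legendre_at_1 legendre_at_minus_1)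

text \<open>Induction on the degree of \<open>q\<close>: writing P_(m+1) as the derivative of
  \<open>legendre_prim m\<close> and integrating by parts leaves P_(m+2) and P_m paired with q',
  whose degree is smaller.\<close>

lemma legendre_orthogonal:
  assumes "Polynomial.degree q < n"
  shows "poly_ip (legendre n) q = 0"
  using assms
proof (induction "Polynomial.degree q" arbitrary: q n rule: less_induct)
  case less
  obtain m where n: "n = m + 1"
    using less.prems by (cases n) auto
  have "poly_ip (legendre_prim m) (pderiv q) = 0"
  \<comment> \<open>Differentiation lowers the degree only if it is positive, so constants are
    treated directly.\<close>
  proof (cases "Polynomial.degree q = 0")
    case True
    then have "pderiv q = 0" by (simp add: pderiv_eq_0_iff)
    then show ?thesis by simp
  next
    case False
    then have "poly_ip (legendre i) (pderiv q) = 0" if "i \<ge> m" for i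
      using that less.prems n by (intro less.hyps) (auto simp: degree_pderiv)
    then show ?thesis
      by (simp add: legendre_prim_def poly_ip_linear)
  qed
  then show ?case
    using poly_ip_by_parts[of "legendre_prim m" q]
    by (simp add: n pderiv_legendre_prim legendre_prim_at_1 legendre_prim_at_minus_1)
qed

text \<open>The alternative of a zero derivative covers m = 0, where no degree can be strictly
  smaller.\<close>

lemma degree_pderiv_legendre:
  "Polynomial.degree (pderiv (legendre n)) < m \<or> pderiv (legendre n) = 0" if "n \<le> m"
  using that degree_legendre[of n] by (auto simp: degree_pderiv pderiv_eq_0_iff)

text \<open>If m is at most n, P_m' has degree too small to meet P_n. Otherwise integration by parts
  moves the derivative to P_n, and only the boundary terms survive.\<close>

lemma poly_ip_pderiv_legendre:
  "poly_ip (pderiv (legendre m)) (legendre n) = (if m \<le> n then 0 else 1 - (- 1) ^ (m + n))"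
proof -
  have *: "poly_ip (legendre i) (pderiv (legendre j)) = 0" if "j \<le> i" for i j
    using degree_pderiv_legendre[OF that] by (auto intro: legendre_orthogonal)
  show ?thesis
    using *[of m n] *[of n m] poly_ip_by_parts[of "legendre m" "legendre n"]
    by (auto simp: poly_ip_commute[of "pderiv (legendre m)"] legendre_at_1 legendre_at_minus_1 power_add)
qed

lemma poly_ip_legendre:
  "poly_ip (legendre m) (legendre n) = (if m = n then 2 / (2 * real n + 1) else 0)"
proof -
  have 1: "poly_ip (legendre i) (legendre j) = 0" if "j < i" for i j
    using that degree_legendre[of j] by (intro legendre_orthogonal) auto
  have 2: "poly_ip (legendre k) (legendre k) = 2 / (2 * real k + 1)" for k
  proof (cases k)
    case 0
    have "poly_ip 1 1 = 2" by (simp add: poly_ip_def poly_1[abs_def])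
    then show ?thesis by (simp add: 0 legendre_def one_pCons)
  next
    case (Suc i)
    \<comment> \<open>The norm comes from the recurrence: paired with P_(i+1), P_i' contributes 0
      and P_(i+2)' contributes 1 - (-1)^(2i+3) = 2.\<close>
    have "(2 * real i + 3) * poly_ip (legendre k) (legendre k) =
        poly_ip (pderiv (legendre (i + 2)) - pderiv (legendre i)) (legendre k)"
      by (simp only: pderiv_legendre_diff poly_ip_linear Suc Suc_eq_plus1)
    also have "\<dots> = 2"
      by (simp add: poly_ip_linear poly_ip_pderiv_legendre Suc flip: power_add)
    finally show ?thesis by (simp add: Suc field_simps)
  qed
  show ?thesis
    using 1[of m n] 1[of n m] 2 by (cases m n rule: linorder_cases) (auto simp: poly_ip_commute)
qed

section \<open>Trial and test functions in Legendre form\<close>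

lemma poly_eq_if_pderiv_eq:
  fixes p q :: "real poly"
  assumes "pderiv p = pderiv q" and "poly p x = poly q x"
  shows "p = q"
proof -
  have "pderiv (p - q) = 0" using assms by (simp add: pderiv_diff)
  then obtain c where c: "p - q = [:c:]" by (auto dest: pderiv_iszero)
  then have "c = poly (p - q) x" by simp
  also have "\<dots> = 0" using assms(2) by simp
  finally show ?thesis using c by simp
qed

text \<open>Combines the Rodrigues factor of R_j with the factor (-2)^(j+1) (j+1)! of the (j+1)-st
  derivative. Here z = (j+1)! cancels, and y is what remains of the factorial in the denominator:
  j+2 for \<open>phi\<close>, 1 for \<open>psi\<close>.\<close>

lemma rodrigues_constant:
  fixes x y z :: real
  assumes "z \<noteq> 0"
  shows "(- 1 / 2) ^ n * x / (y * z) * ((- 2) ^ Suc n * z) = - 2 * x / y"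
proof -
  have "(- 1 / 2) ^ n * (- 2) ^ n = (1 :: real)"
    by (simp flip: power_mult_distrib)
  moreover have "a * x / (y * z) * ((- 2 * b) * z) = (a * b) * (- 2 * x / y)" for a b
    using assms by simp
  ultimately show ?thesis by (simp only: power_Suc)
qed

definition phi_poly :: "nat \<Rightarrow> real poly" where
  "phi_poly j = Polynomial.smult (- 4 / (real j + 2)) (legendre_prim j - legendre_prim (j + 1))"

definition psi_poly :: "nat \<Rightarrow> real poly" where
  "psi_poly k = Polynomial.smult (- 2) (legendre_prim k + legendre_prim (k + 1))"

text \<open>One extra derivative raises the order from j to j+1, which is exactly the exponent of
  1-x^2 in the weight, so \<open>higher_pderiv_minus_legendre\<close> applies. Equal derivatives and
  a common zero at 1 then identify the polynomials.\<close>

lemma phi_eq_poly: "phi j = poly (phi_poly j)"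
proof -
  let ?p = "[:1, -1:] ^ 2 * [:1, 1:] ^ 1 * jacobi_R (real 2) (real 1) j"
  have w: "[:1, -1:] ^ (2 + j) * [:1, 1:] ^ (1 + j) = [:1, -1:] * ([:1, 0, -1:] ^ Suc j :: real poly)"
    unfolding legendre_weight_factor[of "Suc j"]
    by (simp only: power_add power_Suc power2_eq_square power_one_right mult_ac)
  have c: "(- 1 / 2) ^ j * fact 2 / fact (2 + j) * ((- 2) ^ Suc j * fact (Suc j)) = - 4 / (real j + 2)"
    using rodrigues_constant[of "fact (Suc j)" j "fact 2" "real j + 2"]
    by (simp add: add.commute fact_numeral)
  have "pderiv ?p = Polynomial.smult ((- 1 / 2) ^ j * fact 2 / fact (2 + j))
      ((pderiv ^^ Suc j) ([:1, -1:] * [:1, 0, -1:] ^ Suc j))"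
    unfolding jacobi_R_poly w pderiv_smult by simp
  also have "\<dots> = pderiv (phi_poly j)"
    unfolding higher_pderiv_minus_legendre smult_smult c
    by (simp add: phi_poly_def pderiv_smult pderiv_diff pderiv_minus pderiv_legendre_prim)
  finally have "?p = phi_poly j"
    by (rule poly_eq_if_pderiv_eq[where x = 1]) (simp add: phi_poly_def legendre_prim_at_1)
  moreover have "phi j = poly ?p"
    by (rule ext) (simp add: phi_def power2_eq_square algebra_simps)
  ultimately show ?thesis by simp
qed

lemma psi_eq_poly: "psi k = poly (psi_poly k)"
proof -
  let ?p = "[:1, -1:] ^ 1 * [:1, 1:] ^ 2 * jacobi_R (real 1) (real 2) k"
  have w: "[:1, -1:] ^ (1 + k) * [:1, 1:] ^ (2 + k) = [:1, 1:] * ([:1, 0, -1:] ^ Suc k :: real poly)"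
    unfolding legendre_weight_factor[of "Suc k"]
    by (simp only: power_add power_Suc power2_eq_square power_one_right mult_ac)
  have c: "(- 1 / 2) ^ k * fact 1 / fact (1 + k) * ((- 2) ^ Suc k * fact (Suc k)) = (- 2 :: real)"
    using rodrigues_constant[of "fact (Suc k)" k "fact 1" "1"]
    by simp
  have "pderiv ?p = Polynomial.smult ((- 1 / 2) ^ k * fact 1 / fact (1 + k))
      ((pderiv ^^ Suc k) ([:1, 1:] * [:1, 0, -1:] ^ Suc k))"
    unfolding jacobi_R_poly w pderiv_smult by simp
  also have "\<dots> = pderiv (psi_poly k)"
    unfolding higher_pderiv_plus_legendre smult_smult c
    by (simp add: psi_poly_def pderiv_smult pderiv_add pderiv_minus pderiv_legendre_prim)
  finally have "?p = psi_poly k"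
    by (rule poly_eq_if_pderiv_eq[where x = 1]) (simp add: psi_poly_def legendre_prim_at_1)
  moreover have "psi k = poly ?p"
    by (rule ext) (simp add: psi_def power2_eq_square algebra_simps)
  ultimately show ?thesis by simp
qed

lemma pderiv_phi_poly:
  "pderiv (phi_poly j) = Polynomial.smult (- 4 / (real j + 2)) (legendre (j + 1) - legendre (j + 2))"
  by (simp add: phi_poly_def pderiv_smult pderiv_diff pderiv_minus pderiv_legendre_prim)

lemma pderiv_psi_poly:
  "pderiv (psi_poly k) = Polynomial.smult (- 2) (legendre (k + 1) + legendre (k + 2))"
  by (simp add: psi_poly_def pderiv_smult pderiv_add pderiv_minus pderiv_legendre_prim)

lemma poly_ip_pderiv_psi: "poly_ip (pderiv p) (psi_poly k) = - poly_ip p (pderiv (psi_poly k))"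
  using poly_ip_by_parts[of p "psi_poly k"]
  by (simp add: psi_poly_def legendre_prim_at_1 legendre_prim_at_minus_1)

section \<open>Matrix entries and their bands\<close>

lemma B1_entry:
  assumes "k < N - 2" and "j < N - 2"
  shows "B1 N $$ (k, j) = (if j = k then 2 * (real k + 1) * (real k + 3) else 0)"
proof -
  have "B1 N $$ (k, j) = - poly_ip (pderiv (pderiv (phi_poly j))) (pderiv (psi_poly k)) / h k"
    using assms
    by (simp add: B1_def phi_eq_poly psi_eq_poly deriv_poly ip_poly poly_ip_pderiv_psi
        numeral_3_eq_3)
  also have "\<dots> = - ((real k + 1) * (real k + 2) * (real k + 3) / (real j + 2)) *
      poly_ip (pderiv (legendre (j + 1)) - pderiv (legendre (j + 2))) (legendre (k + 1) + legendre (k + 2))"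
    by (simp add: pderiv_phi_poly pderiv_psi_poly pderiv_smult pderiv_diff
        pderiv_minus poly_ip_smult h_def)
      (simp add: field_simps)
  \<comment> \<open>For j < k all four pairings vanish by degree. For j > k each P_m' pairs with
    P_(k+1) + P_(k+2) to 2, since exactly one of the two has opposite parity, and the difference
    cancels. For j = k only the pairing of P_(k+2)' with P_(k+1) survives.\<close>
  also have "\<dots> = (if j = k then 2 * (real k + 1) * (real k + 3) else 0)"
    by (cases k j rule: linorder_cases)
       (auto simp: poly_ip_linear poly_ip_pderiv_legendre field_simps le_Suc_eq)
  finally show ?thesis .
qed

text \<open>The prefactor, shared up to sign by the next two lemmas, is (-4/(j+2)) (-2) /
  h_k.\<close>

lemma E2_entry:
  assumes "k < N - 2" and "j < N - 2"
  shows "E2 N $$ (k, j) = (real k + 1) * (real k + 2) * (real k + 3) / (real j + 2) *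
      poly_ip (legendre (j + 1) - legendre (j + 2)) (legendre (k + 1) + legendre (k + 2))"
proof -
  have "E2 N $$ (k, j) = poly_ip (pderiv (phi_poly j)) (pderiv (psi_poly k)) / h k"
    using assms
    by (simp add: E2_def phi_eq_poly psi_eq_poly deriv_poly ip_poly poly_ip_pderiv_psi
        numeral_2_eq_2)
  then show ?thesis
    by (simp add: pderiv_phi_poly pderiv_psi_poly poly_ip_smult h_def)
      (simp add: field_simps)
qed

lemma E1_entry:
  assumes "k < N - 2" and "j < N - 2"
  shows "E1 N $$ (k, j) = - ((real k + 1) * (real k + 2) * (real k + 3) / (real j + 2)) *
      poly_ip (legendre (j + 1) - legendre (j + 2)) (legendre_prim k + legendre_prim (k + 1))"
  using assms
  by (simp add: E1_def phi_eq_poly psi_eq_poly deriv_poly ip_poly pderiv_phi_poly psi_poly_def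
      poly_ip_smult h_def)
      (simp add: field_simps)

lemma E0_entry:
  assumes "k < N - 2" and "j < N - 2"
  shows "E0 N $$ (k, j) = (real k + 1) * (real k + 2) * (real k + 3) / (real j + 2) *
      poly_ip (legendre_prim j - legendre_prim (j + 1)) (legendre_prim k + legendre_prim (k + 1))"
  using assms
  by (simp add: E0_def phi_eq_poly psi_eq_poly ip_poly phi_poly_def psi_poly_def
      poly_ip_smult h_def)
      (simp add: field_simps)

text \<open>An entry can be nonzero only if the Legendre indices j+1, j+2 and k+1, k+2 overlap; the
  surviving squared norms give the values.\<close>

lemma E2_band:
  shows "k < N - 2 \<Longrightarrow> E2 N $$ (k, k) =
      4 * (real k + 1) * (real k + 3) / ((2 * real k + 3) * (2 * real k + 5))"
    and "k + 1 < N - 2 \<Longrightarrow> E2 N $$ (k, k + 1) = 2 * (real k + 1) * (real k + 2) / (2 * real k + 5)"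
    and "k + 1 < N - 2 \<Longrightarrow> E2 N $$ (k + 1, k) = - 2 * (real k + 3) * (real k + 4) / (2 * real k + 5)"
    and "\<lbrakk>k < N - 2; j < N - 2; j + 1 < k \<or> k + 1 < j\<rbrakk> \<Longrightarrow> E2 N $$ (k, j) = 0"
  by (auto simp: E2_entry poly_ip_linear poly_ip_legendre divide_simps) (auto simp: algebra_simps)

text \<open>Here the indices j+1, j+2 meet k, ..., k+3, because each \<open>legendre_prim\<close>
  spreads over two indices; this widens the band to 2.\<close>

lemma E1_band:
  shows "k < N - 2 \<Longrightarrow> E1 N $$ (k, k) =
      4 * (real k + 1) * (real k + 3) / ((2 * real k + 3) * (2 * real k + 5))"
    and "k + 1 < N - 2 \<Longrightarrow> E1 N $$ (k, k + 1) = - 8 * (real k + 1) * (real k + 2) /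
      ((2 * real k + 3) * (2 * real k + 5) * (2 * real k + 7))"
    and "k + 2 < N - 2 \<Longrightarrow> E1 N $$ (k, k + 2) = - 2 * (real k + 1) * (real k + 2) * (real k + 3) /
      ((real k + 4) * (2 * real k + 5) * (2 * real k + 7))"
    and "k + 1 < N - 2 \<Longrightarrow> E1 N $$ (k + 1, k) = 8 * (real k + 3) * (real k + 4) /
      ((2 * real k + 3) * (2 * real k + 5) * (2 * real k + 7))"
    and "k + 2 < N - 2 \<Longrightarrow> E1 N $$ (k + 2, k) = - 2 * (real k + 3) * (real k + 4) * (real k + 5) /
      ((real k + 2) * (2 * real k + 5) * (2 * real k + 7))"
    and "\<lbrakk>k < N - 2; j < N - 2; j + 2 < k \<or> k + 2 < j\<rbrakk> \<Longrightarrow> E1 N $$ (k, j) = 0"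
  by (auto simp: E1_entry legendre_prim_def poly_ip_linear poly_ip_legendre divide_simps)
     (auto simp: algebra_simps)

text \<open>Both sides now spread over four consecutive indices, hence a band of width 3.\<close>

lemma E0_band:
  shows "k < N - 2 \<Longrightarrow> E0 N $$ (k, k) =
      3 * (real k + 1) * (real k + 3) / (2 * pochhammer (real k + 1 / 2) 4)"
    and "k + 1 < N - 2 \<Longrightarrow> E0 N $$ (k, k + 1) =
      3 * pochhammer (real k + 1) 2 / (4 * pochhammer (real k + 3 / 2) 3)"
    and "k + 2 < N - 2 \<Longrightarrow> E0 N $$ (k, k + 2) = - 3 * pochhammer (real k + 1) 3 /
      (4 * (real k + 4) * pochhammer (real k + 3 / 2) 4)"
    and "k + 3 < N - 2 \<Longrightarrow> E0 N $$ (k, k + 3) = - pochhammer (real k + 1) 3 /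
      (4 * (real k + 5) * pochhammer (real k + 5 / 2) 3)"
    and "k + 1 < N - 2 \<Longrightarrow> E0 N $$ (k + 1, k) =
      - 3 * pochhammer (real k + 3) 2 / (4 * pochhammer (real k + 3 / 2) 3)"
    and "k + 2 < N - 2 \<Longrightarrow> E0 N $$ (k + 2, k) = - 3 * pochhammer (real k + 3) 3 /
      (4 * (real k + 2) * pochhammer (real k + 3 / 2) 4)"
    and "k + 3 < N - 2 \<Longrightarrow> E0 N $$ (k + 3, k) = pochhammer (real k + 4) 3 /
      (4 * (real k + 2) * pochhammer (real k + 5 / 2) 3)"
    and "\<lbrakk>k < N - 2; j < N - 2; j + 3 < k \<or> k + 3 < j\<rbrakk> \<Longrightarrow> E0 N $$ (k, j) = 0"
  by (simp_all add: E0_entry legendre_prim_def poly_ip_linear poly_ip_legendre eval_nat_numeral pochhammer_Suc)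
     (simp_all add: divide_simps, auto simp: algebra_simps)

section \<open>Exact sparsity patterns and assembly\<close>

lemma pochhammer_nz: "pochhammer x n \<noteq> 0" if "x > 0" for x :: real
  using pochhammer_pos[OF that, of n] by simp

text \<open>Inside the band the closed forms are quotients of products of nonzero factors, so no
  entry vanishes accidentally.\<close>

lemma E2_nonzero_iff:
  assumes "k < N - 2" and "j < N - 2"
  shows "E2 N $$ (k, j) \<noteq> 0 \<longleftrightarrow> j = k \<or> j = k + 1 \<or> k = j + 1"
proof (cases "j + 1 < k \<or> k + 1 < j")
  case True
  with assms show ?thesis by (auto simp: E2_band)
next
  case False
  then have "j = k \<or> j = k + 1 \<or> k = j + 1" by arith
  moreover from this have "E2 N $$ (k, j) \<noteq> 0"
    \<comment> \<open>Simplification rewrites \<open>k + 1\<close> to \<open>Suc k\<close>, so the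
      band rules are also supplied in successor form.\<close>
    using assms by (elim disjE) (simp_all add: E2_band
        E2_band[unfolded add_2_eq_Suc' Suc_eq_plus1[symmetric]] add_nonneg_eq_0_iff)
  ultimately show ?thesis by blast
qed

lemma E1_nonzero_iff:
  assumes "k < N - 2" and "j < N - 2"
  shows "E1 N $$ (k, j) \<noteq> 0 \<longleftrightarrow> j = k \<or> j = k + 1 \<or> j = k + 2 \<or> k = j + 1 \<or> k = j + 2"
proof (cases "j + 2 < k \<or> k + 2 < j")
  case True
  with assms show ?thesis by (auto simp: E1_band)
next
  case False
  then have "j = k \<or> j = k + 1 \<or> j = k + 2 \<or> k = j + 1 \<or> k = j + 2" by arith
  moreover from this have "E1 N $$ (k, j) \<noteq> 0"
    using assms by (elim disjE) (simp_all add: E1_band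
        E1_band[unfolded add_2_eq_Suc' Suc_eq_plus1[symmetric]] add_nonneg_eq_0_iff)
  ultimately show ?thesis by blast
qed

lemma E0_nonzero_iff:
  assumes "k < N - 2" and "j < N - 2"
  shows "E0 N $$ (k, j) \<noteq> 0 \<longleftrightarrow> j = k \<or> j = k + 1 \<or> j = k + 2 \<or> j = k + 3 \<or> k = j + 1 \<or> k = j + 2 \<or> k = j + 3"
proof (cases "j + 3 < k \<or> k + 3 < j")
  case True
  with assms show ?thesis by (auto simp: E0_band)
next
  case False
  then have "j = k \<or> j = k + 1 \<or> j = k + 2 \<or> j = k + 3 \<or> k = j + 1 \<or> k = j + 2 \<or> k = j + 3" by arith
  moreover from this have "E0 N $$ (k, j) \<noteq> 0"
    using assms by (elim disjE) (simp_all add: E0_band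
        E0_band[unfolded add_2_eq_Suc' Suc_eq_plus1[symmetric]] add_nonneg_eq_0_iff pochhammer_nz)
  ultimately show ?thesis by blast
qed

theorem theorem3:
  fixes N :: nat
  assumes "N \<ge> 3"
  shows
    "((\<forall>k. k \<le> N - 3 \<longrightarrow>
        B1 N $$ (k, k) = 2 * (real k + 1) * (real k + 3)) \<and>
      (\<forall>k \<le> N - 3. \<forall>j \<le> N - 3. B1 N $$ (k, j) \<noteq> 0 \<longleftrightarrow> j = k)) \<and>
     ((\<forall>k. k + 1 \<le> N - 3 \<longrightarrow>
        E2 N $$ (k, k + 1) = 2 * (real k + 1) * (real k + 2) / (2 * real k + 5)) \<and>
      (\<forall>k. k + 1 \<le> N - 3 \<longrightarrow>
        E2 N $$ (k + 1, k) = - 2 * (real k + 3) * (real k + 4) / (2 * real k + 5)) \<and>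
      (\<forall>k. k \<le> N - 3 \<longrightarrow>
        E2 N $$ (k, k) = 4 * (real k + 1) * (real k + 3) / ((2 * real k + 3) * (2 * real k + 5))) \<and>
      (\<forall>k \<le> N - 3. \<forall>j \<le> N - 3. E2 N $$ (k, j) \<noteq> 0 \<longleftrightarrow>
        j = k \<or> j = k + 1 \<or> k = j + 1)) \<and>
     ((\<forall>k. k \<le> N - 3 \<longrightarrow>
        E1 N $$ (k, k) = 4 * (real k + 1) * (real k + 3) / ((2 * real k + 3) * (2 * real k + 5))) \<and>
      (\<forall>k. k + 1 \<le> N - 3 \<longrightarrow>
        E1 N $$ (k, k + 1) = - 8 * (real k + 1) * (real k + 2) /
          ((2 * real k + 3) * (2 * real k + 5) * (2 * real k + 7))) \<and>
      (\<forall>k. k + 2 \<le> N - 3 \<longrightarrow>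
        E1 N $$ (k, k + 2) = - 2 * (real k + 1) * (real k + 2) * (real k + 3) /
          ((real k + 4) * (2 * real k + 5) * (2 * real k + 7))) \<and>
      (\<forall>k. k + 1 \<le> N - 3 \<longrightarrow>
        E1 N $$ (k + 1, k) = 8 * (real k + 3) * (real k + 4) /
          ((2 * real k + 3) * (2 * real k + 5) * (2 * real k + 7))) \<and>
      (\<forall>k. k + 2 \<le> N - 3 \<longrightarrow>
        E1 N $$ (k + 2, k) = - 2 * (real k + 3) * (real k + 4) * (real k + 5) /
          ((real k + 2) * (2 * real k + 5) * (2 * real k + 7))) \<and>
      (\<forall>k \<le> N - 3. \<forall>j \<le> N - 3. E1 N $$ (k, j) \<noteq> 0 \<longleftrightarrow>
        j = k \<or> j = k + 1 \<or> j = k + 2 \<or> k = j + 1 \<or> k = j + 2)) \<and>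
     ((\<forall>k. k \<le> N - 3 \<longrightarrow>
        E0 N $$ (k, k) = 3 * (real k + 1) * (real k + 3) / (2 * pochhammer (real k + 1 / 2) 4)) \<and>
      (\<forall>k. k + 1 \<le> N - 3 \<longrightarrow>
        E0 N $$ (k, k + 1) = 3 * pochhammer (real k + 1) 2 / (4 * pochhammer (real k + 3 / 2) 3)) \<and>
      (\<forall>k. k + 2 \<le> N - 3 \<longrightarrow>
        E0 N $$ (k, k + 2) = - 3 * pochhammer (real k + 1) 3 /
          (4 * (real k + 4) * pochhammer (real k + 3 / 2) 4)) \<and>
      (\<forall>k. k + 3 \<le> N - 3 \<longrightarrow>
        E0 N $$ (k, k + 3) = - pochhammer (real k + 1) 3 /
          (4 * (real k + 5) * pochhammer (real k + 5 / 2) 3)) \<and>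
      (\<forall>k. k + 1 \<le> N - 3 \<longrightarrow>
        E0 N $$ (k + 1, k) = - 3 * pochhammer (real k + 3) 2 / (4 * pochhammer (real k + 3 / 2) 3)) \<and>
      (\<forall>k. k + 2 \<le> N - 3 \<longrightarrow>
        E0 N $$ (k + 2, k) = - 3 * pochhammer (real k + 3) 3 /
          (4 * (real k + 2) * pochhammer (real k + 3 / 2) 4)) \<and>
      (\<forall>k. k + 3 \<le> N - 3 \<longrightarrow>
        E0 N $$ (k + 3, k) = pochhammer (real k + 4) 3 /
          (4 * (real k + 2) * pochhammer (real k + 5 / 2) 3)) \<and>
      (\<forall>k \<le> N - 3. \<forall>j \<le> N - 3. E0 N $$ (k, j) \<noteq> 0 \<longleftrightarrow>
        j = k \<or> j = k + 1 \<or> j = k + 2 \<or> j = k + 3 \<or> k = j + 1 \<or> k = j + 2 \<or> k = j + 3))"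
proof -
  \<comment> \<open>Subtraction is truncated: without N \<ge> 3 the left side would still admit i =
    0 although the matrices are empty.\<close>
  have *: "i \<le> N - 3 \<longleftrightarrow> i < N - 2" for i
    using assms by auto
  show ?thesis
    unfolding *
    by (intro conjI allI impI)
       (simp_all only: B1_entry E2_band E1_band E0_band E2_nonzero_iff E1_nonzero_iff E0_nonzero_iff refl if_True, auto)
qed

end
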